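(* Let $\mathcal{H}_1,\mathcal{H}_2,\mathcal{H}_3,\mathcal{H}_4$ be separable Hilbert spaces, $r\in\mathbb{N}$, $M\in L_2(\mathcal{H}_1,\mathcal{H}_4)$, $B\in\mathcal{B}(\mathcal{H}_3,\mathcal{H}_4)$, $C\in\mathcal{B}(\mathcal{H}_1,\mathcal{H}_2)$. Put $K:=P_{\overline{\operatorname{ran}B}}MP_{(\ker C)^\perp}$, suppose that the set $\mathcal{Y}_r$ defined in the context is nonempty, and let $(K)_r\in\mathcal{Y}_r$. Let $Z:=B^\dagger(K)_r$ and $\hat X:=ZC^\dagger:\operatorname{dom}(C^\dagger)\subset\mathcal{H}_2\to\mathcal{H}_3$. Suppose that there exists $c>0$ such that $\|Ch\|\ge c\,\|h+\ker C\|$ for all $h\in\ker Z\cap(\ker C)^\perp$, where $\|h+\ker C\|=\inf\{\|h+k\|:k\in\ker C\}$ is the quotient norm on $\mathcal{H}_1/\ker C$. Then $\hat X$ is bounded.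
   Context: All Hilbert spaces are over a common field $\mathbb{R}$ or $\mathbb{C}$ and may be finite- or infinite-dimensional. $\mathcal{B}(\mathcal{H},\mathcal{K})$ denotes the bounded everywhere-defined operators, $L_2(\mathcal{H},\mathcal{K})$ the Hilbert--Schmidt operators with norm $\|\cdot\|_{L_2}$, and $\mathcal{B}_{00,r}(\mathcal{H},\mathcal{K})$ the bounded operators with range of dimension at most $r$. $P_V$ is the orthogonal projector onto a closed subspace $V$. Moore--Penrose inverse: for $T\in\mathcal{B}(\mathcal{H},\mathcal{K})$, $T^\dagger$ is the (possibly unbounded) linear operator with $\operatorname{dom}(T^\dagger)=\operatorname{ran}T\oplus(\operatorname{ran}T)^\perp$ and $T^\dagger(h+k)=(T|_{(\ker T)^\perp})^{-1}h$ for $h\in\operatorname{ran}T$, $k\in(\operatorname{ran}T)^\perp$. $\mathcal{Y}_r=\{Y\in\mathcal{B}_{00,r}(\mathcal{H}_1,\mathcal{H}_4):\ \operatorname{ran}Y\subset\operatorname{dom}(B^\dagger),\ \|K-Y\|_{L_2}\le\|K-\tilde Y\|_{L_2}\ \forall\,\tilde Y\in\mathcal{B}_{00,r}(\mathcal{H}_1,\mathcal{H}_4)\}$; it consists of the rank-$r$ truncated SVDs $(K)_r$ of $K$ that map into $\operatorname{dom}(B^\dagger)$. *)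

theory Defs
  imports "HOL-Analysis.Analysis" "Jordan_Normal_Form.Conjugate"
begin

text \<open>
  The scalar field, real or complex. The instances below are the intended ones; up to
  isomorphism there are no others: \<open>x + conjugate x\<close> is real because
  \<open>(1 + x) * conjugate (1 + x)\<close> is, so every \<open>x\<close> is a root of a real polynomial of degree two.
\<close>

class rclike = real_normed_field + conjugatable_field +
  assumes mult_conjugate: "x * conjugate x = (norm x)\<^sup>2 *\<^sub>R 1"

instance real :: rclike
  by standard (simp add: power2_eq_square)

instance complex :: rclike
  by standard (simp add: complex_norm_square scaleR_conv_of_real del: of_real_power)

text \<open>
  A Hilbert space over \<open>'k\<close>: the type \<open>'a\<close> carries addition, norm and completeness, the record
  carries scalar multiplication and the inner product (linear in the first argument).
\<close>

record ('k, 'a) hilbert =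
  smult :: "'k \<Rightarrow> 'a \<Rightarrow> 'a"
  ip :: "'a \<Rightarrow> 'a \<Rightarrow> 'k"

locale hilbert_space = vector_space "smult H"
  for H :: "('k::rclike, 'a::banach) hilbert" +
  assumes smult_of_real: "smult H (of_real t) x = t *\<^sub>R x"
    and ip_add_left: "ip H (x + y) z = ip H x z + ip H y z"
    and ip_smult_left: "ip H (smult H a x) y = a * ip H x y"
    and ip_commute: "ip H x y = conjugate (ip H y x)"
    and ip_same: "ip H x x = of_real ((norm x)\<^sup>2)"

lemma hilbert_space_real:
  "hilbert_space \<lparr>smult = scaleR, ip = (inner :: 'a::{real_inner, banach} \<Rightarrow> 'a \<Rightarrow> real)\<rparr>"
  by unfold_locales
    (auto simp: algebra_simps inner_commute power2_norm_eq_inner)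

lemma hilbert_space_complex:
  "hilbert_space \<lparr>smult = (*), ip = (\<lambda>x y :: complex. x * cnj y)\<rparr>"
  by unfold_locales
    (simp_all add: algebra_simps scaleR_conv_of_real flip: complex_norm_square)

definition bounded_ops ::
  "('k::rclike, 'a::banach) hilbert \<Rightarrow> ('k, 'b::banach) hilbert \<Rightarrow> ('a \<Rightarrow> 'b) set" where
  "bounded_ops H K =
    {T. Vector_Spaces.linear (smult H) (smult K) T \<and> (\<exists>b. \<forall>x. norm (T x) \<le> b * norm x)}"

text \<open>The finite spanning set is needed because \<open>dim\<close> is \<open>0\<close> on infinite-dimensional spaces.\<close>

definition rank_le_ops ::
  "nat \<Rightarrow> ('k::rclike, 'a::banach) hilbert \<Rightarrow> ('k, 'b::banach) hilbert \<Rightarrow> ('a \<Rightarrow> 'b) set" where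
  "rank_le_ops r H K =
    {T \<in> bounded_ops H K. (\<exists>E. finite E \<and> range T = module.span (smult K) E) \<and>
       vector_space.dim (smult K) (range T) \<le> r}"

definition orthonormal_basis :: "('k::rclike, 'a::banach) hilbert \<Rightarrow> 'a set \<Rightarrow> bool" where
  "orthonormal_basis H E \<longleftrightarrow>
    (\<forall>e\<in>E. norm e = 1) \<and> (\<forall>e\<in>E. \<forall>f\<in>E. e \<noteq> f \<longrightarrow> ip H e f = 0) \<and>
    closure (module.span (smult H) E) = UNIV"

definition hilbert_schmidt ::
  "('k::rclike, 'a::banach) hilbert \<Rightarrow> ('k, 'b::banach) hilbert \<Rightarrow> ('a \<Rightarrow> 'b) set" where
  "hilbert_schmidt H K =
    {T \<in> bounded_ops H K.
      \<exists>E. orthonormal_basis H E \<and> (\<lambda>e. (norm (T e))\<^sup>2) summable_on E}"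

text \<open>
  The sum does not depend on the orthonormal basis. Outside the Hilbert--Schmidt class
  the value is meaningless.
\<close>

definition hs_norm :: "('k::rclike, 'a::banach) hilbert \<Rightarrow> ('a \<Rightarrow> 'b::banach) \<Rightarrow> real" where
  "hs_norm H T =
    sqrt (\<Sum>\<^sub>\<infinity>e\<in>(SOME E. orthonormal_basis H E). (norm (T e))\<^sup>2)"

definition orth_compl :: "('k::rclike, 'a::banach) hilbert \<Rightarrow> 'a set \<Rightarrow> 'a set" where
  "orth_compl H V = {x. \<forall>v\<in>V. ip H x v = 0}"

definition proj :: "('k::rclike, 'a::banach) hilbert \<Rightarrow> 'a set \<Rightarrow> 'a \<Rightarrow> 'a" where
  "proj H V x = (THE v. v \<in> V \<and> x - v \<in> orth_compl H V)"

definition ker :: "('a \<Rightarrow> 'b::zero) \<Rightarrow> 'a set" where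
  "ker T = {x. T x = 0}"

text \<open>
  The Moore--Penrose inverse of \<open>T\<close> is the partial operator with domain \<open>mp_dom\<close> and values
  \<open>mp_inv\<close>; outside \<open>mp_dom\<close> the function \<open>mp_inv\<close> is unspecified. The point \<open>h\<close> is the
  component in \<open>range T\<close> of \<open>y = h + k\<close>.
\<close>

definition mp_dom :: "('k::rclike, 'b::banach) hilbert \<Rightarrow> ('a \<Rightarrow> 'b) \<Rightarrow> 'b set" where
  "mp_dom K T = {h + k | h k. h \<in> range T \<and> k \<in> orth_compl K (range T)}"

definition mp_inv ::
  "('k::rclike, 'a::banach) hilbert \<Rightarrow> ('k, 'b::banach) hilbert \<Rightarrow> ('a \<Rightarrow> 'b) \<Rightarrow> 'b \<Rightarrow> 'a" where
  "mp_inv H K T y =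
    inv_into (orth_compl H (ker T)) T
      (THE h. h \<in> range T \<and> y - h \<in> orth_compl K (range T))"

text \<open>Best rank-\<open>r\<close> approximations \<open>Y\<close> of \<open>A\<close> with \<open>ran Y\<close> inside the domain of the
  Moore--Penrose inverse of \<open>B\<close>.\<close>

definition truncations ::
  "('k::rclike, 'a::banach) hilbert \<Rightarrow> ('k, 'd::banach) hilbert \<Rightarrow> ('c::banach \<Rightarrow> 'd) \<Rightarrow> nat
    \<Rightarrow> ('a \<Rightarrow> 'd) \<Rightarrow> ('a \<Rightarrow> 'd) set" where
  "truncations H\<^sub>1 H\<^sub>4 B r A =
    {Y \<in> rank_le_ops r H\<^sub>1 H\<^sub>4. range Y \<subseteq> mp_dom H\<^sub>4 B \<and>
      (\<forall>Y' \<in> rank_le_ops r H\<^sub>1 H\<^sub>4.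
        hs_norm H\<^sub>1 (\<lambda>x. A x - Y x) \<le> hs_norm H\<^sub>1 (\<lambda>x. A x - Y' x))}"

definition quotient_norm :: "'a::real_normed_vector set \<Rightarrow> 'a \<Rightarrow> real" where
  "quotient_norm N h = (INF k\<in>N. norm (h + k))"

end

theory Submission
  imports Defs
begin

text \<open>
  Since \<open>C\<close> is bounded below on \<open>W = ker Z \<inter> (ker C)\<^sup>\<bottom>\<close>, the image \<open>C W\<close> is closed. As \<open>(K)\<^sub>r\<close> has
  finite rank, \<open>(ker C)\<^sup>\<bottom>\<close> is \<open>W\<close> plus finitely many vectors; adding them one at a time keeps the
  image under the injective \<open>C\<close> closed, and the distance of the image of the new vector to the
  previous image controls its coefficient. Hence \<open>\<parallel>Z x\<parallel> \<le> b \<parallel>C x\<parallel>\<close> on \<open>(ker C)\<^sup>\<bottom>\<close>, and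
  \<open>x = C\<^sup>\<dagger> y\<close> satisfies \<open>\<parallel>C x\<parallel> \<le> \<parallel>y\<parallel>\<close>. The extension argument is carried
  out over the reals, for which the scalar field has dimension at most two.
\<close>

section \<open>Scalars\<close>

text \<open>For nonzero \<open>t\<close>, the product with the conjugate is \<open>t\<close> squared
  by \<open>mult_conjugate\<close>, and one factor \<open>t\<close> cancels.\<close>

lemma rclike_conjugate_of_real: "conjugate (of_real t :: 'k::rclike) = of_real t"
proof (cases "t = 0")
  case False
  have "of_real t * conjugate (of_real t :: 'k) = of_real t * of_real t"
    using mult_conjugate[of "of_real t :: 'k"]
    by (simp add: scaleR_conv_of_real power2_eq_square flip: of_real_mult)
  then show ?thesis using False by simp
qed (simp add: conjugate_zero)

text \<open>Expanding the real quantity \<open>(1 + x) * conjugate (1 + x)\<close> isolates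
  \<open>x + conjugate x\<close> among terms that are real by \<open>mult_conjugate\<close>.\<close>

lemma rclike_add_conjugate_Reals: "(x::'k::rclike) + conjugate x \<in> \<real>"
proof -
  have conj1: "conjugate (1 + x) = 1 + conjugate x"
    using rclike_conjugate_of_real[of 1, where 'k='k] by (simp add: conjugate_dist_add)
  have "x + conjugate x = (1 + x) * (1 + conjugate x) - 1 - x * conjugate x"
    by (simp add: algebra_simps)
  also have "\<dots> = (norm (1 + x))\<^sup>2 *\<^sub>R 1 - 1 - (norm x)\<^sup>2 *\<^sub>R 1"
    by (simp only: mult_conjugate flip: conj1)
  also have "\<dots> \<in> \<real>"
    by (intro Reals_diff Reals_1) (simp_all only: scaleR_conv_of_real mult_1_right Reals_of_real)
  finally show ?thesis .
qed

lemma rclike_selfconjugate_Reals: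
  assumes "conjugate x = (x::'k::rclike)"
  shows "x \<in> \<real>"
proof -
  have "x = (x + conjugate x) / of_real 2" using assms by simp
  then show ?thesis using rclike_add_conjugate_Reals Reals_divide Reals_of_real by metis
qed

text \<open>A nonzero skew element \<open>j\<close> serves as imaginary unit: the quotient of two
  skew elements is self-conjugate, hence real.\<close>

lemma rclike_real_span:
  obtains j :: "'k::rclike" where "\<And>a. \<exists>s t. a = of_real s + of_real t * j"
proof (cases "\<forall>a::'k. conjugate a = a")
  case True
  then have "a \<in> \<real>" for a :: 'k by (simp add: rclike_selfconjugate_Reals)
  \<comment> \<open>Trivial conjugation makes every scalar real, so \<open>j = 0\<close>
    suffices.\<close>
  then have "\<exists>s t. a = of_real s + of_real t * (0::'k)" for a :: 'k by (auto elim!: Reals_cases)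
  then show thesis by (rule that)
next
  case False
  then obtain b :: 'k where b: "conjugate b \<noteq> b" by auto
  define j where "j = b - conjugate b"
  have conj_diff: "conjugate (a - conjugate a) = - (a - conjugate a)" for a :: 'k
    using conjugate_dist_add[of a "- conjugate a"] by (simp add: conjugate_neg)
  have j: "j \<noteq> 0" "conjugate j = - j" using b conj_diff by (auto simp: j_def)
  have "\<exists>s t. a = of_real s + of_real t * j" for a :: 'k
  proof -
    define u where "u = a - conjugate a"
    have "u * inverse j * j = u" using j by simp
    \<comment> \<open>Conjugation negates both \<open>u\<close> and \<open>j\<close>, so it fixes
      their quotient.\<close>
    then have "conjugate (u * inverse j) * conjugate j = conjugate u"
      by (simp only: flip: conjugate_dist_mul)
    then have "conjugate (u * inverse j) = u * inverse j"
      using j conj_diff[of a] by (simp add: u_def field_simps)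
    then obtain t where t: "u * inverse j = of_real t"
      using rclike_selfconjugate_Reals Reals_cases by metis
    obtain s where s: "a + conjugate a = of_real s"
      using rclike_add_conjugate_Reals Reals_cases by metis
    have "2 * a = of_real s + u" using s by (simp add: u_def algebra_simps flip: s)
    also have "u = of_real t * j" using t j by (simp add: field_simps)
    finally have "a = of_real (s/2) + of_real (t/2) * j" by (simp add: field_simps)
    then show ?thesis by blast
  qed
  then show thesis by (rule that)
qed

section \<open>Hilbert spaces\<close>

context hilbert_space
begin

section \<open>Algebra of the inner product\<close>

lemma ip_zero_left: "ip H 0 y = 0"
  using ip_smult_left[of 0 0 y] by simp

lemma ip_minus_left: "ip H (- x) y = - ip H x y"
  using ip_add_left[of x "- x" y] by (simp add: ip_zero_left eq_neg_iff_add_eq_0 add.commute)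

lemma ip_diff_left: "ip H (x - y) z = ip H x z - ip H y z"
  using ip_add_left[of x "- y" z] by (simp add: ip_minus_left)

lemma ip_scaleR_left: "ip H (t *\<^sub>R x) y = of_real t * ip H x y"
  using ip_smult_left[of "of_real t" x y] by (simp add: smult_of_real)

lemma ip_add_right: "ip H z (x + y) = ip H z x + ip H z y"
  using ip_commute ip_add_left conjugate_dist_add by metis

lemma ip_smult_right: "ip H y (smult H a x) = conjugate a * ip H y x"
  using ip_commute ip_smult_left conjugate_dist_mul by metis

lemma ip_minus_right: "ip H y (- x) = - ip H y x"
  using ip_commute ip_minus_left conjugate_neg by metis

lemma ip_diff_right: "ip H z (x - y) = ip H z x - ip H z y"
  using ip_add_right[of z x "- y"] by (simp add: ip_minus_right)

lemma ip_eq_0_commute: "ip H x y = 0 \<longleftrightarrow> ip H y x = 0"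
  using ip_commute conjugate_zero_iff by metis

section \<open>Orthogonality expressed through the norm\<close>

lemma parallelogram:
  fixes x y :: 'a
  shows "(norm (x + y))\<^sup>2 + (norm (x - y))\<^sup>2 = 2 * (norm x)\<^sup>2 + 2 * (norm y)\<^sup>2"
proof -
  have "ip H (x + y) (x + y) + ip H (x - y) (x - y) = 2 * ip H x x + 2 * ip H y y"
    by (simp add: ip_add_left ip_add_right ip_diff_left ip_diff_right)
  then have "of_real ((norm (x + y))\<^sup>2 + (norm (x - y))\<^sup>2)
      = (of_real (2 * (norm x)\<^sup>2 + 2 * (norm y)\<^sup>2) :: 'k)"
    by (simp only: ip_same of_real_add of_real_mult of_real_numeral)
  then show ?thesis by (simp only: of_real_eq_iff)
qed

lemma pythagoras:
  assumes "ip H x y = 0"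
  shows "(norm (x + y))\<^sup>2 = (norm x)\<^sup>2 + (norm y)\<^sup>2"
proof -
  have "ip H (x + y) (x + y) = ip H x x + ip H y y"
    using assms ip_eq_0_commute[of x y] by (simp add: ip_add_left ip_add_right)
  then have "of_real ((norm (x + y))\<^sup>2) = (of_real ((norm x)\<^sup>2 + (norm y)\<^sup>2) :: 'k)"
    by (simp only: ip_same of_real_add)
  then show ?thesis by (simp only: of_real_eq_iff)
qed

lemma norm_le_norm_add:
  assumes "ip H x y = 0"
  shows "norm x \<le> norm (x + y)"
proof (rule power2_le_imp_le)
  show "(norm x)\<^sup>2 \<le> (norm (x + y))\<^sup>2" by (simp add: pythagoras[OF assms])
qed simp

text \<open>This criterion replaces inner products by norm inequalities, from which closed
  complements and minimising projections follow directly. For the converse, subtracting from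
  \<open>x\<close> its component along \<open>v\<close> shortens it strictly unless that component
  vanishes.\<close>

lemma ip_eq_0_iff_norm: "ip H x v = 0 \<longleftrightarrow> (\<forall>a. norm x \<le> norm (x - smult H a v))"
proof
  assume 0: "ip H x v = 0"
  show "\<forall>a. norm x \<le> norm (x - smult H a v)"
  proof
    fix a
    have "ip H x (- smult H a v) = 0" using 0 by (simp add: ip_minus_right ip_smult_right)
    from norm_le_norm_add[OF this] show "norm x \<le> norm (x - smult H a v)" by simp
  qed
next
  assume le: "\<forall>a. norm x \<le> norm (x - smult H a v)"
  show "ip H x v = 0"
  proof (cases "v = 0")
    case True
    then show ?thesis using ip_zero_left ip_eq_0_commute by blast
  next
    case False
    \<comment> \<open>The coefficient of the orthogonal projection of \<open>x\<close> onto the line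
      through \<open>v\<close>.\<close>
    define a where "a = ip H x v / of_real ((norm v)\<^sup>2)"
    have "ip H (x - smult H a v) v = 0"
      using False by (simp add: ip_diff_left ip_smult_left ip_same a_def)
    then have "ip H (x - smult H a v) (smult H a v) = 0" by (simp add: ip_smult_right)
    from pythagoras[OF this]
    have "(norm x)\<^sup>2 = (norm (x - smult H a v))\<^sup>2 + (norm (smult H a v))\<^sup>2" by simp
    moreover have "(norm x)\<^sup>2 \<le> (norm (x - smult H a v))\<^sup>2"
      using le by (simp add: power_mono)
    ultimately have "(norm (smult H a v))\<^sup>2 \<le> 0" by linarith
    then have "smult H a v = 0" by simp
    then show ?thesis using False by (simp add: a_def)
  qed
qed

section \<open>Orthogonal complements and projections\<close>

lemma closed_orth_compl: "closed (orth_compl H S)"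
proof -
  have "orth_compl H S = (\<Inter>v\<in>S. \<Inter>a. {x. norm x \<le> norm (x - smult H a v)})"
    by (auto simp: orth_compl_def ip_eq_0_iff_norm)
  also have "closed \<dots>"
    by (intro closed_INT ballI closed_Collect_le continuous_intros)
  finally show ?thesis .
qed

lemma subspace_orth_compl: "Real_Vector_Spaces.subspace (orth_compl H S)"
  by (auto simp: orth_compl_def Real_Vector_Spaces.subspace_def ip_zero_left ip_add_left ip_scaleR_left)

lemma norm_le_norm_add_orth:
  assumes "h \<in> orth_compl H N" and "k \<in> N"
  shows "norm h \<le> norm (h + k)"
  using assms by (intro norm_le_norm_add) (simp add: orth_compl_def)

text \<open>The sets of almost nearest points of \<open>S\<close> are closed, nested and, by the
  parallelogram law, of diameter tending to zero. By completeness they share a point, which attains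
  the distance from \<open>x\<close> to \<open>S\<close>; minimality makes the residual
  orthogonal.\<close>

lemma projection_exists:
  assumes S: "subspace S" and cl: "closed S"
  obtains v where "v \<in> S" and "x - v \<in> orth_compl H S"
proof -
  have S0: "S \<noteq> {}" using subspace_0[OF S] by auto
  define d where "d = infdist x S"
  have d_le: "d \<le> norm (x - s)" if "s \<in> S" for s
    using infdist_le[OF that, of x] by (simp add: d_def dist_norm)
  have d0: "d \<ge> 0" by (simp add: d_def infdist_nonneg)
  define A where "A n = {s \<in> S. (norm (x - s))\<^sup>2 \<le> d\<^sup>2 + inverse (real (Suc n))}" for n
  have diam: "(norm (s - t))\<^sup>2 \<le> 4 * inverse (real (Suc n))" if "s \<in> A n" "t \<in> A n" for s t n
  proof -
    \<comment> \<open>The midpoint stays in \<open>S\<close>, so it is at distance at least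
      \<open>d\<close> from \<open>x\<close>; this is what the parallelogram law needs.\<close>
    have m: "(1/2) *\<^sub>R (s + t) \<in> S"
      using that subspace_scale[OF S, of "s + t" "of_real (1/2)"] subspace_add[OF S, of s t]
      unfolding smult_of_real A_def by auto
    have "(x - s) + (x - t) = 2 *\<^sub>R (x - (1/2) *\<^sub>R (s + t))"
      by (simp add: algebra_simps scaleR_2)
    then have "norm ((x - s) + (x - t)) = 2 * norm (x - (1/2) *\<^sub>R (s + t))" by simp
    also have "\<dots> \<ge> 2 * d" using d_le[OF m] by simp
    finally have "(2 * d)\<^sup>2 \<le> (norm ((x - s) + (x - t)))\<^sup>2" using d0 by (intro power_mono) auto
    moreover have "norm (s - t) = norm ((x - s) - (x - t))" by (simp add: norm_minus_commute)
    ultimately show ?thesis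
      using parallelogram[of "x - s" "x - t"] that by (simp add: A_def power_mult_distrib)
  qed
  obtain v where v: "\<And>n. v \<in> A n"
  proof (rule decreasing_closed_nest[of A])
    show "closed (A n)" for n
      unfolding A_def Collect_conj_eq
      by (intro closed_Int closed_Collect_le continuous_intros) (simp add: cl)
    show "A n \<noteq> {}" for n
    proof -
      have "sqrt (d\<^sup>2 + inverse (real (Suc n))) > d"
        using d0 by (intro real_less_rsqrt) simp
      then obtain s where s: "s \<in> S" "dist x s < sqrt (d\<^sup>2 + inverse (real (Suc n)))"
        using S0 cINF_less_iff[of S "dist x"] by (auto simp: d_def infdist_def)
      then have "(norm (x - s))\<^sup>2 \<le> (sqrt (d\<^sup>2 + inverse (real (Suc n))))\<^sup>2"
        by (intro power_mono) (auto simp: dist_norm)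
      then show ?thesis using s by (auto simp: A_def)
    qed
    show "A n \<subseteq> A m" if "m \<le> n" for m n
    proof -
      have "inverse (real (Suc n)) \<le> inverse (real (Suc m))" using that by (simp add: field_simps)
      then show ?thesis unfolding A_def by (blast intro: order_trans add_left_mono)
    qed
    show "\<exists>n. \<forall>x\<in>A n. \<forall>y\<in>A n. dist x y < e" if "e > 0" for e
    proof -
      have "e\<^sup>2 / 4 > 0" using that by simp
      then obtain n where n: "inverse (real (Suc n)) < e\<^sup>2 / 4"
        using reals_Archimedean by blast
      have "norm (s - t) < e" if "s \<in> A n" "t \<in> A n" for s t
      proof (rule power_less_imp_less_base)
        show "(norm (s - t))\<^sup>2 < e\<^sup>2" using diam[OF that] n by linarith
      qed (use \<open>e > 0\<close> in simp)
      then show ?thesis by (auto simp: dist_norm)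
    qed
  qed auto
  have vS: "v \<in> S" using v[of 0] by (simp add: A_def)
  have "(norm (x - v))\<^sup>2 \<le> d\<^sup>2 + e" if e: "e > 0" for e
  proof -
    obtain n where "inverse (real (Suc n)) < e" using reals_Archimedean[OF e] by auto
    then show ?thesis using v[of n] by (simp add: A_def)
  qed
  then have "(norm (x - v))\<^sup>2 \<le> d\<^sup>2" by (rule field_le_epsilon)
  then have vd: "norm (x - v) \<le> d" using d0 by (rule power2_le_imp_le)
  \<comment> \<open>Competitors \<open>v + smult H a s\<close> in \<open>S\<close> turn minimality
    into the norm criterion for orthogonality.\<close>
  have "norm (x - v) \<le> norm ((x - v) - smult H a s)" if s: "s \<in> S" for a s
    using vd d_le[of "v + smult H a s"] subspace_add[OF S vS subspace_scale[OF S s, of a]]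
    by (simp add: algebra_simps)
  then have "x - v \<in> orth_compl H S" by (simp add: orth_compl_def ip_eq_0_iff_norm)
  with vS show thesis by (rule that)
qed

text \<open>By Pythagoras, \<open>h\<close> is no longer than any element of its coset. This turns
  the hypothesis on \<open>C\<close> into a lower bound in the ordinary norm.\<close>

lemma norm_le_quotient_norm:
  assumes h: "h \<in> orth_compl H N" and "N \<noteq> {}"
  shows "norm h \<le> quotient_norm N h"
  unfolding quotient_norm_def
  by (rule cINF_greatest[OF assms(2) norm_le_norm_add_orth[OF h]])

text \<open>Since 1 and \<open>j\<close> span the scalars over the reals, \<open>E\<close> together
  with its multiples by \<open>j\<close> suffices.\<close>

lemma span_smult_finite_real_span:
  assumes "finite E"
  obtains F where "finite F" and "span E \<subseteq> Real_Vector_Spaces.span F"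
proof -
  obtain j :: 'k where j: "\<And>a. \<exists>s t. a = of_real s + of_real t * j"
    using rclike_real_span by blast
  let ?F = "E \<union> smult H j ` E"
  have "x \<in> Real_Vector_Spaces.span ?F" if x: "x \<in> span E" for x
  proof -
    obtain u where u: "x = (\<Sum>e\<in>E. smult H (u e) e)"
      using x span_finite[OF assms] by auto
    have "smult H a e \<in> Real_Vector_Spaces.span ?F" if e: "e \<in> E" for a e
    proof -
      obtain s t where "a = of_real s + of_real t * j" using j by blast
      then have "smult H a e = s *\<^sub>R e + t *\<^sub>R smult H j e"
        by (simp add: scale_left_distrib smult_of_real flip: scale_scale)
      moreover have "e \<in> Real_Vector_Spaces.span ?F" "smult H j e \<in> Real_Vector_Spaces.span ?F"
        using e by (auto intro: Real_Vector_Spaces.span_base)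
      ultimately show ?thesis
        by (simp add: Real_Vector_Spaces.span_add Real_Vector_Spaces.span_scale)
    qed
    then show ?thesis unfolding u by (intro Real_Vector_Spaces.span_sum)
  qed
  then show thesis using assms by (intro that[of ?F]) auto
qed

end

section \<open>The Moore--Penrose inverse\<close>

lemma bounded_ops_bounded_linear:
  assumes "hilbert_space H" "hilbert_space K" "T \<in> bounded_ops H K"
  shows "bounded_linear T"
proof -
  interpret H: hilbert_space H by fact
  interpret K: hilbert_space K by fact
  interpret T: Vector_Spaces.linear "smult H" "smult K" T
    using assms(3) by (simp add: bounded_ops_def)
  obtain b where b: "\<And>x. norm (T x) \<le> b * norm x" using assms(3) by (auto simp: bounded_ops_def)
  show ?thesis
  proof (rule bounded_linear_intro[of _ b])
    show "T (x + y) = T x + T y" for x y by (rule T.add)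
    show "T (t *\<^sub>R x) = t *\<^sub>R T x" for t x
      using T.scale[of "of_real t" x] by (simp add: H.smult_of_real K.smult_of_real)
    show "norm (T x) \<le> norm x * b" for x using b[of x] by (simp add: mult.commute)
  qed
qed

locale hilbert_operator = dom: hilbert_space H + cod: hilbert_space K
  for H :: "('k::rclike, 'a::banach) hilbert" and K :: "('k, 'b::banach) hilbert" +
  fixes T :: "'a \<Rightarrow> 'b"
  assumes bounded_op: "T \<in> bounded_ops H K"
begin

sublocale bounded_linear T
  using dom.hilbert_space_axioms cod.hilbert_space_axioms bounded_op
  by (rule bounded_ops_bounded_linear)

lemma subspace_ker: "dom.subspace (ker T)" and closed_ker: "closed (ker T)"
proof -
  interpret T: Vector_Spaces.linear "smult H" "smult K" T
    using bounded_op by (simp add: bounded_ops_def)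
  show "dom.subspace (ker T)"
    by (auto simp: dom.subspace_def ker_def T.add T.scale zero)
  show "closed (ker T)"
    unfolding ker_def using linear_continuous_on[OF bounded_linear_axioms]
    by (intro closed_Collect_eq) auto
qed

lemma inj_on_orth_compl_ker: "inj_on T (orth_compl H (ker T))"
proof (rule inj_onI)
  fix x y assume xy: "x \<in> orth_compl H (ker T)" "y \<in> orth_compl H (ker T)" "T x = T y"
  then have "x - y \<in> ker T" by (simp add: ker_def diff)
  moreover have "x - y \<in> orth_compl H (ker T)"
    using xy Real_Vector_Spaces.subspace_diff[OF dom.subspace_orth_compl] by blast
  ultimately have "ip H (x - y) (x - y) = 0" by (auto simp: orth_compl_def)
  then show "x = y" by (simp add: dom.ip_same)
qed

text \<open>Subtracting the projection of \<open>x\<close> onto the closed kernel does not change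
  \<open>T x\<close>.\<close>

lemma image_orth_compl_ker: "T ` orth_compl H (ker T) = range T"
proof -
  have "T x \<in> T ` orth_compl H (ker T)" for x
  proof -
    obtain v where v: "v \<in> ker T" "x - v \<in> orth_compl H (ker T)"
      using dom.projection_exists[OF subspace_ker closed_ker] by blast
    then have "T x = T (x - v)" by (simp add: ker_def diff)
    then show ?thesis using v by blast
  qed
  then show ?thesis by blast
qed

lemma range_component_unique:
  assumes "h \<in> range T" "y - h \<in> orth_compl K (range T)"
    and "h' \<in> range T" "y - h' \<in> orth_compl K (range T)"
  shows "h = h'"
proof -
  have "(y - h') - (y - h) \<in> orth_compl K (range T)"
    using assms Real_Vector_Spaces.subspace_diff[OF cod.subspace_orth_compl] by blast
  moreover have "h - h' \<in> range T" using assms(1,3) by (auto simp flip: diff)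
  ultimately have "ip K (h - h') (h - h') = 0" by (auto simp: orth_compl_def)
  then show ?thesis by (simp add: cod.ip_same)
qed

text \<open>Characterises Moore-Penrose values by two orthogonality conditions, so that later
  identities only require a candidate satisfying both.\<close>

lemma mp_inv_unique:
  assumes "x \<in> orth_compl H (ker T)" and "y - T x \<in> orth_compl K (range T)"
  shows "mp_inv H K T y = x"
proof -
  have "(THE h. h \<in> range T \<and> y - h \<in> orth_compl K (range T)) = T x"
    using assms range_component_unique by (intro the_equality) blast+
  then show ?thesis
    using assms inj_on_orth_compl_ker by (simp add: mp_inv_def)
qed

lemma mp_inv_props:
  assumes "y \<in> mp_dom K T"
  shows mp_inv_orth: "mp_inv H K T y \<in> orth_compl H (ker T)"
    and mp_inv_residual: "y - T (mp_inv H K T y) \<in> orth_compl K (range T)"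
proof -
  obtain h k where "y = h + k" "h \<in> range T" and k: "k \<in> orth_compl K (range T)"
    using assms by (auto simp: mp_dom_def)
  moreover then obtain x where x: "x \<in> orth_compl H (ker T)" "h = T x"
    using image_orth_compl_ker by (metis imageE)
  ultimately have y: "y - T x \<in> orth_compl K (range T)" by simp
  show "mp_inv H K T y \<in> orth_compl H (ker T)"
      "y - T (mp_inv H K T y) \<in> orth_compl K (range T)"
    using x(1) y by (simp_all only: mp_inv_unique[OF x(1) y])
qed

lemma mp_inv_add:
  assumes "y \<in> mp_dom K T" "z \<in> mp_dom K T"
  shows "mp_inv H K T (y + z) = mp_inv H K T y + mp_inv H K T z"
proof (rule mp_inv_unique)
  show "mp_inv H K T y + mp_inv H K T z \<in> orth_compl H (ker T)"
    using assms mp_inv_orth Real_Vector_Spaces.subspace_add[OF dom.subspace_orth_compl] by blast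
  have "(y - T (mp_inv H K T y)) + (z - T (mp_inv H K T z)) \<in> orth_compl K (range T)"
    using assms mp_inv_residual Real_Vector_Spaces.subspace_add[OF cod.subspace_orth_compl] by blast
  then show "y + z - T (mp_inv H K T y + mp_inv H K T z) \<in> orth_compl K (range T)"
    by (simp add: add algebra_simps)
qed

lemma mp_inv_scaleR:
  assumes "y \<in> mp_dom K T"
  shows "mp_inv H K T (t *\<^sub>R y) = t *\<^sub>R mp_inv H K T y"
proof (rule mp_inv_unique)
  show "t *\<^sub>R mp_inv H K T y \<in> orth_compl H (ker T)"
    using assms mp_inv_orth Real_Vector_Spaces.subspace_scale[OF dom.subspace_orth_compl] by blast
  have "t *\<^sub>R (y - T (mp_inv H K T y)) \<in> orth_compl K (range T)"
    using assms mp_inv_residual Real_Vector_Spaces.subspace_scale[OF cod.subspace_orth_compl] by blast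
  then show "t *\<^sub>R y - T (t *\<^sub>R mp_inv H K T y) \<in> orth_compl K (range T)"
    by (simp add: scaleR algebra_simps)
qed

lemma mp_inv_eq_0_iff:
  assumes "y \<in> mp_dom K T"
  shows "mp_inv H K T y = 0 \<longleftrightarrow> y \<in> orth_compl K (range T)"
proof
  show "y \<in> orth_compl K (range T)" if "mp_inv H K T y = 0"
    using mp_inv_residual[OF assms] that by (simp add: zero)
  show "mp_inv H K T y = 0" if "y \<in> orth_compl K (range T)"
    using that by (intro mp_inv_unique)
      (auto simp: zero Real_Vector_Spaces.subspace_0[OF dom.subspace_orth_compl])
qed

text \<open>Applying \<open>T\<close> to the Moore-Penrose value returns the range component of
  \<open>y\<close>, which is orthogonal to the residual. The bound holds even when the Moore-Penrose
  inverse is unbounded.\<close>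

lemma norm_apply_mp_inv_le:
  assumes "y \<in> mp_dom K T"
  shows "norm (T (mp_inv H K T y)) \<le> norm y"
proof -
  have "ip K (T (mp_inv H K T y)) (y - T (mp_inv H K T y)) = 0"
    using mp_inv_residual[OF assms] by (subst cod.ip_eq_0_commute) (auto simp: orth_compl_def)
  from cod.norm_le_norm_add[OF this] show ?thesis by simp
qed

end

section \<open>Finite-dimensional extensions\<close>

text \<open>For nonzero \<open>a\<close>, dividing by \<open>a\<close> turns the right-hand norm
  into the distance from \<open>u\<close> to a point of \<open>S\<close>.\<close>

lemma abs_infdist_le_norm_add:
  fixes S :: "'a::real_normed_vector set"
  assumes S: "subspace S" and s: "s \<in> S"
  shows "\<bar>a\<bar> * infdist u S \<le> norm (s + a *\<^sub>R u)"
proof (cases "a = 0")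
  case False
  have "- (1/a) *\<^sub>R s \<in> S" using subspace_scale[OF S s] .
  from infdist_le[OF this, of u] have "infdist u S \<le> norm (u + (1/a) *\<^sub>R s)" by (simp add: dist_norm)
  then have "\<bar>a\<bar> * infdist u S \<le> \<bar>a\<bar> * norm (u + (1/a) *\<^sub>R s)" by (intro mult_left_mono) auto
  also have "\<dots> = norm (a *\<^sub>R (u + (1/a) *\<^sub>R s))" by simp
  also have "a *\<^sub>R (u + (1/a) *\<^sub>R s) = s + a *\<^sub>R u" using False by (simp add: algebra_simps)
  finally show ?thesis .
qed simp

text \<open>The positive distance from \<open>u\<close> to \<open>S\<close> makes the coefficients
  of \<open>u\<close> along a convergent sequence Cauchy; the remaining parts then converge inside
  \<open>S\<close>.\<close>

lemma closed_span_insert: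
  fixes S :: "'a::real_normed_vector set"
  assumes S: "subspace S" and cl: "closed S" and u: "u \<notin> S"
  shows "closed (span (insert u S))"
proof -
  have S0: "S \<noteq> {}" using subspace_0[OF S] by auto
  have d: "infdist u S > 0" using infdist_pos_not_in_closed[OF cl S0 u] .
  show ?thesis
    unfolding closed_sequential_limits
  proof (intro allI impI, elim conjE)
    fix x l assume x: "\<forall>n::nat. x n \<in> span (insert u S)" and lim: "x \<longlonglongrightarrow> l"
    then have "\<forall>n. \<exists>a. x n - a *\<^sub>R u \<in> S"
      by (simp add: span_breakdown_eq span_eq_iff[THEN iffD2, OF S])
    then obtain a where a: "\<And>n. x n - a n *\<^sub>R u \<in> S" by metis
    have "\<bar>a m - a n\<bar> * infdist u S \<le> norm (x m - x n)" for m n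
      using abs_infdist_le_norm_add[OF S subspace_diff[OF S a[of m] a[of n]], of "a m - a n" u] by (simp add: algebra_simps)
    moreover have "Cauchy x" using lim by (rule LIMSEQ_imp_Cauchy)
    ultimately have "Cauchy a"
      unfolding Cauchy_iff
    proof (intro allI impI)
      fix e :: real assume "e > 0"
      assume le': "\<And>m n. \<bar>a m - a n\<bar> * infdist u S \<le> norm (x m - x n)"
        and "\<forall>e>0. \<exists>M. \<forall>m\<ge>M. \<forall>n\<ge>M. norm (x m - x n) < e"
      moreover have "e * infdist u S > 0" using \<open>e > 0\<close> d by simp
      ultimately obtain M where "\<And>m n. m \<ge> M \<Longrightarrow> n \<ge> M \<Longrightarrow> norm (x m - x n) < e * infdist u S"
        by blast
      then have "\<forall>m\<ge>M. \<forall>n\<ge>M. norm (a m - a n) < e"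
        using le' d by (metis mult_less_cancel_right_pos order_le_less_trans real_norm_def)
      then show "\<exists>M. \<forall>m\<ge>M. \<forall>n\<ge>M. norm (a m - a n) < e" by blast
    qed
    then obtain t where t: "a \<longlonglongrightarrow> t" using Cauchy_convergent convergent_def by blast
    have "(\<lambda>n. x n - a n *\<^sub>R u) \<longlonglongrightarrow> l - t *\<^sub>R u" using lim t by (intro tendsto_intros)
    then have "l - t *\<^sub>R u \<in> S" by (rule closed_sequentially[OF cl a])
    then show "l \<in> span (insert u S)"
      by (auto simp: span_breakdown_eq span_eq_iff[THEN iffD2, OF S])
  qed
qed

text \<open>Closedness and the estimate are carried through the induction together: closedness of
  the old image gives a positive distance, which bounds the coefficient of the next vector.
  \<open>Z\<close> is merely linear, since it is compared with \<open>C x\<close> rather than with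
  \<open>x\<close>.\<close>

lemma bounded_relative_finite_extension:
  fixes C :: "'a::real_vector \<Rightarrow> 'b::real_normed_vector" and Z :: "'a \<Rightarrow> 'c::real_normed_vector"
  assumes C: "linear C" and Z: "linear Z" and V: "subspace V" and inj: "inj_on C V"
    and W: "subspace W" "W \<subseteq> V" and cl: "closed (C ` W)" and ZW: "\<And>x. x \<in> W \<Longrightarrow> Z x = 0"
    and F: "finite F" "F \<subseteq> V"
  shows "closed (C ` span (W \<union> F)) \<and> (\<exists>b. \<forall>x\<in>span (W \<union> F). norm (Z x) \<le> b * norm (C x))"
  using F
proof (induction F rule: finite_induct)
  case empty
  then show ?case using cl ZW W by (auto simp: span_eq_iff[THEN iffD2, OF W(1)] intro!: exI[of _ 0])
next
  case (insert v F)
  let ?S = "span (W \<union> F)" and ?S' = "span (W \<union> insert v F)"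
  have SV: "?S \<subseteq> V" using W insert.prems V by (intro span_minimal) auto
  from insert obtain b where cS: "closed (C ` ?S)"
    and b: "\<And>x. x \<in> ?S \<Longrightarrow> norm (Z x) \<le> b * norm (C x)" by auto
  show ?case
  proof (cases "v \<in> ?S")
    case True
    then have "?S' = ?S" by (simp add: span_redundant)
    then show ?thesis using cS b by auto
  next
    case False
    \<comment> \<open>Injectivity on \<open>V\<close> keeps the new image vector outside the old
      image, so its distance to that closed set is positive.\<close>
    have Cv: "C v \<notin> C ` ?S"
      using inj SV insert.prems False by (auto dest: inj_onD)
    have sub: "subspace (C ` ?S)" using C by (simp add: linear_subspace_image)
    have "span (insert (C v) (C ` ?S)) = C ` span (insert v ?S)"
      using linear_span_image[OF C, of "insert v ?S"] by simp
    moreover have "span (insert v ?S) = ?S'" by (simp add: span_insert span_span)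
    ultimately have "closed (C ` ?S')" using closed_span_insert[OF sub cS Cv] by simp
    moreover have "\<exists>b. \<forall>x\<in>?S'. norm (Z x) \<le> b * norm (C x)"
    proof (intro exI ballI)
      define d where "d = infdist (C v) (C ` ?S)"
      have d: "d > 0" unfolding d_def
        using infdist_pos_not_in_closed[OF cS _ Cv] span_zero by blast
      fix x assume "x \<in> ?S'"
      then obtain a where s: "x - a *\<^sub>R v \<in> ?S" by (auto simp: span_breakdown_eq)
      define s where "s = x - a *\<^sub>R v"
      have x: "x = s + a *\<^sub>R v" and s: "s \<in> ?S" using s by (auto simp: s_def)
      have Cx: "C x = C s + a *\<^sub>R C v" and Zx: "Z x = Z s + a *\<^sub>R Z v"
        unfolding x using C Z by (simp_all add: linear_add linear_scale)
      have a: "\<bar>a\<bar> \<le> norm (C x) / d"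
        using abs_infdist_le_norm_add[OF sub, of "C s" a "C v"] s d
        by (simp add: Cx d_def field_simps)
      have "norm (C s) \<le> norm (C x) + \<bar>a\<bar> * norm (C v)"
        using norm_triangle_ineq4[of "C x" "a *\<^sub>R C v"] by (simp add: Cx)
      also have "\<dots> \<le> norm (C x) + norm (C x) / d * norm (C v)"
        using a by (intro add_left_mono mult_right_mono) auto
      finally have Cs: "norm (C s) \<le> (1 + norm (C v) / d) * norm (C x)" by (simp add: field_simps)
      have "norm (Z x) \<le> norm (Z s) + \<bar>a\<bar> * norm (Z v)"
        using norm_triangle_ineq[of "Z s" "a *\<^sub>R Z v"] by (simp add: Zx)
      \<comment> \<open>The induction hypothesis does not fix the sign of \<open>b\<close>, hence
        the absolute value.\<close>
      also have "norm (Z s) \<le> \<bar>b\<bar> * norm (C s)"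
        using b[OF s] by (rule order_trans) (intro mult_right_mono, auto)
      also have "\<dots> \<le> \<bar>b\<bar> * ((1 + norm (C v) / d) * norm (C x))"
        using Cs by (intro mult_left_mono) auto
      also have "\<bar>a\<bar> * norm (Z v) \<le> norm (C x) / d * norm (Z v)"
        using a by (intro mult_right_mono) auto
      finally show "norm (Z x) \<le> (\<bar>b\<bar> * (1 + norm (C v) / d) + norm (Z v) / d) * norm (C x)"
        by (simp add: algebra_simps)
    qed
    ultimately show ?thesis by blast
  qed
qed

text \<open>\<open>F\<close> consists of preimages in \<open>V\<close> of a basis of the
  finite-dimensional image; subtracting a combination of them moves any vector of \<open>V\<close>
  into the kernel.\<close>

lemma finite_rank_complement:
  fixes L :: "'a::real_vector \<Rightarrow> 'b::real_vector"
  assumes L: "linear L" and V: "subspace V" and G: "finite G" "L ` V \<subseteq> span G"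
  obtains F where "finite F" "F \<subseteq> V" "V \<subseteq> span ((V \<inter> ker L) \<union> F)"
proof -
  obtain D where D: "D \<subseteq> L ` V" "independent D" "L ` V \<subseteq> span D"
    by (rule maximal_independent_subset[of "L ` V"])
  have "finite D" using independent_span_bound[OF G(1) D(2)] D(1) G(2) by auto
  then obtain F where F: "F \<subseteq> V" "finite F" "D = L ` F"
    using finite_subset_image D(1) by metis
  have "x \<in> span ((V \<inter> ker L) \<union> F)" if x: "x \<in> V" for x
  proof -
    have "L x \<in> L ` span F" using D(3) x F(3) L by (auto simp: linear_span_image)
    then obtain f where f: "f \<in> span F" "L x = L f" by auto
    have "f \<in> V" using f span_minimal[OF F(1) V] by auto
    then have "x - f \<in> V \<inter> ker L"
      using x V f L by (simp add: subspace_diff ker_def linear_diff)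
    then have "x - f \<in> span ((V \<inter> ker L) \<union> F)" by (simp add: span_base)
    moreover have "f \<in> span ((V \<inter> ker L) \<union> F)" using f span_mono[of F] by auto
    ultimately show ?thesis using span_add by fastforce
  qed
  then show thesis using F that by blast
qed

section \<open>Boundedness of \<open>Z\<close> composed with the Moore-Penrose inverse of
  \<open>C\<close>\<close>

theorem corollary5p3:
  fixes H\<^sub>1 :: "('k::rclike, 'a::banach) hilbert"
    and H\<^sub>2 :: "('k, 'b::banach) hilbert"
    and H\<^sub>3 :: "('k, 'c::banach) hilbert"
    and H\<^sub>4 :: "('k, 'd::banach) hilbert"
    and r :: nat
    and M K Kr :: "'a \<Rightarrow> 'd" and B :: "'c \<Rightarrow> 'd" and C :: "'a \<Rightarrow> 'b"
    and Z :: "'a \<Rightarrow> 'c" and X :: "'b \<Rightarrow> 'c"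
  assumes "hilbert_space H\<^sub>1" and "separable_space (euclidean :: 'a topology)"
    and "hilbert_space H\<^sub>2" and "separable_space (euclidean :: 'b topology)"
    and "hilbert_space H\<^sub>3" and "separable_space (euclidean :: 'c topology)"
    and "hilbert_space H\<^sub>4" and "separable_space (euclidean :: 'd topology)"
    and "M \<in> hilbert_schmidt H\<^sub>1 H\<^sub>4"
    and "B \<in> bounded_ops H\<^sub>3 H\<^sub>4"
    and "C \<in> bounded_ops H\<^sub>1 H\<^sub>2"
    and "K = proj H\<^sub>4 (closure (range B)) \<circ> M \<circ> proj H\<^sub>1 (orth_compl H\<^sub>1 (ker C))"
    and "truncations H\<^sub>1 H\<^sub>4 B r K \<noteq> {}"
    and "Kr \<in> truncations H\<^sub>1 H\<^sub>4 B r K"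
    and "Z = mp_inv H\<^sub>3 H\<^sub>4 B \<circ> Kr"
    and "X = Z \<circ> mp_inv H\<^sub>1 H\<^sub>2 C"
    and "\<exists>c>0. \<forall>h \<in> ker Z \<inter> orth_compl H\<^sub>1 (ker C).
           norm (C h) \<ge> c * quotient_norm (ker C) h"
  shows "\<exists>b. \<forall>y \<in> mp_dom H\<^sub>2 C. norm (X y) \<le> b * norm y"
proof -
  interpret H1: hilbert_space H\<^sub>1 by fact
  interpret H4: hilbert_space H\<^sub>4 by fact
  interpret C: hilbert_operator H\<^sub>1 H\<^sub>2 C
    using assms(1,3,11) by (simp add: hilbert_operator_def hilbert_operator_axioms_def)
  interpret B: hilbert_operator H\<^sub>3 H\<^sub>4 B
    using assms(5,7,10) by (simp add: hilbert_operator_def hilbert_operator_axioms_def)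
  have Kr: "Kr \<in> rank_le_ops r H\<^sub>1 H\<^sub>4" and Kr_dom: "Kr x \<in> mp_dom H\<^sub>4 B" for x
    using assms(14) by (auto simp: truncations_def)
  interpret Kr: hilbert_operator H\<^sub>1 H\<^sub>4 Kr
    using assms(1,7) Kr by (simp add: hilbert_operator_def hilbert_operator_axioms_def rank_le_ops_def)
  have Z_apply: "Z x = mp_inv H\<^sub>3 H\<^sub>4 B (Kr x)" for x
    by (simp only: assms(15) o_apply)
  \<comment> \<open>The Moore-Penrose inverse of \<open>B\<close> is additive and homogeneous on its
    domain, and \<open>Kr\<close> takes all its values there.\<close>
  have Z: "linear Z"
  proof (rule linearI)
    show "Z (x + y) = Z x + Z y" for x y
      by (simp only: Z_apply Kr.add B.mp_inv_add[OF Kr_dom Kr_dom])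
    show "Z (t *\<^sub>R x) = t *\<^sub>R Z x" for t x
      by (simp only: Z_apply Kr.scaleR B.mp_inv_scaleR[OF Kr_dom])
  qed
  have "Z x = 0 \<longleftrightarrow> Kr x \<in> orth_compl H\<^sub>4 (range B)" for x
    by (simp only: Z_apply B.mp_inv_eq_0_iff[OF Kr_dom])
  \<comment> \<open>This makes \<open>ker Z\<close> closed although \<open>B\<^sup>\<dagger>\<close> may be unbounded.\<close>
  then have kerZ: "ker Z = Kr -` orth_compl H\<^sub>4 (range B)" by (auto simp: ker_def)
  define V where "V = orth_compl H\<^sub>1 (ker C)"
  define W where "W = ker Z \<inter> V"
  have V: "subspace V" "closed V" "inj_on C V"
    by (simp_all add: V_def H1.subspace_orth_compl H1.closed_orth_compl C.inj_on_orth_compl_ker)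
  have W: "subspace W" "W \<subseteq> V"
    using V(1) Z by (auto simp: W_def ker_def linear_subspace_kernel intro!: subspace_inter)
  have "closed (ker Z)" unfolding kerZ
    using H4.closed_orth_compl linear_continuous_on[OF Kr.bounded_linear_axioms]
    by (intro closed_vimage) auto
  then have "complete W" using V(2) by (simp add: W_def complete_eq_closed closed_Int)
  moreover obtain c where c: "c > 0" "\<And>h. h \<in> W \<Longrightarrow> norm (C h) \<ge> c * norm h"
  proof -
    obtain c where c: "c > 0" "\<And>h. h \<in> W \<Longrightarrow> norm (C h) \<ge> c * quotient_norm (ker C) h"
      using assms(17) by (auto simp: W_def V_def)
    have "ker C \<noteq> {}" using C.zero unfolding ker_def by blast
    then have "norm h \<le> quotient_norm (ker C) h" if "h \<in> W" for h
      using that H1.norm_le_quotient_norm by (auto simp: W_def V_def)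
    then have "c * norm h \<le> norm (C h)" if "h \<in> W" for h
      using c that by (meson mult_left_mono less_imp_le order_trans)
    then show thesis using that c by blast
  qed
  \<comment> \<open>A bounded linear map that is bounded below on a complete subspace has a complete
    image.\<close>
  ultimately have "complete (C ` W)"
    using W(1) C.bounded_linear_axioms by (intro complete_isometric_image[of c]) auto
  then have clCW: "closed (C ` W)" by (rule complete_imp_closed)
  obtain E where E: "finite E" "range Kr = H4.span E" using Kr by (auto simp: rank_le_ops_def)
  obtain G where G: "finite G" "H4.span E \<subseteq> span G"
    using H4.span_smult_finite_real_span[OF E(1)] .
  have "Kr ` V \<subseteq> span G" using E(2) G(2) by auto
  then obtain F where F: "finite F" "F \<subseteq> V" "V \<subseteq> span ((V \<inter> ker Kr) \<union> F)"
    by (rule finite_rank_complement[OF Kr.linear V(1) G(1)])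
  \<comment> \<open>Finite rank is known for \<open>Kr\<close>, so the complement is built for its
    kernel and then transferred to the larger kernel of \<open>Z\<close>.\<close>
  have "V \<inter> ker Kr \<subseteq> W"
    unfolding W_def kerZ using subspace_0[OF H4.subspace_orth_compl] by (auto simp: ker_def)
  then have VF: "V \<subseteq> span (W \<union> F)" using F(3) span_mono[of "(V \<inter> ker Kr) \<union> F" "W \<union> F"] by blast
  have "\<exists>b. \<forall>x\<in>span (W \<union> F). norm (Z x) \<le> b * norm (C x)"
    using bounded_relative_finite_extension[OF C.linear Z V(1,3) W clCW _ F(1,2)]
    by (simp add: W_def ker_def)
  then obtain b where b: "\<And>x. x \<in> V \<Longrightarrow> norm (Z x) \<le> b * norm (C x)" using VF by blast
  have "norm (X y) \<le> \<bar>b\<bar> * norm y" if y: "y \<in> mp_dom H\<^sub>2 C" for y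
  proof -
    let ?x = "mp_inv H\<^sub>1 H\<^sub>2 C y"
    \<comment> \<open>The Moore-Penrose value lies in \<open>V\<close>, where \<open>Z\<close> is
      controlled by \<open>C\<close>.\<close>
    have "norm (Z ?x) \<le> b * norm (C ?x)" using b C.mp_inv_orth[OF y] by (simp add: V_def)
    also have "\<dots> \<le> \<bar>b\<bar> * norm (C ?x)" by (intro mult_right_mono) auto
    also have "\<dots> \<le> \<bar>b\<bar> * norm y" by (intro mult_left_mono C.norm_apply_mp_inv_le[OF y]) auto
    finally show ?thesis by (simp only: assms(16) o_apply)
  qed
  then show ?thesis by blast
qed

end
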